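(* Let $n\ge 3$, $0<m<\frac{n-2}{n}$, $\eta>0$ and let $\alpha,\beta,\rho_1\in\mathbb{R}$ satisfy $$\beta<0,\qquad \rho_1>0,\qquad \alpha=\frac{2\beta-\rho_1}{1-m},\qquad \frac{2}{1-m}<\frac{\alpha}{\beta}<\frac{n-2}{m},$$ and put $\beta'=-\beta>0$. Let $f$ be a radially symmetric solution of $$\Delta (f^m/m)+\alpha f+\beta x\cdot\nabla f=0,\qquad f>0,\qquad\text{in }\mathbb{R}^n\setminus\{0\}$$ which satisfies $\lim_{|x|\to 0}|x|^{\alpha/\beta}f(x)=\eta$. Write $f(r)$ for $f(x)$ with $r=|x|$. Let $w(r)=r^{\alpha/\beta}f(r)$, $\rho=r^{\rho_1/\beta'}$ and $\overline{w}(\rho)=w(r)$ for $r>0$. Let $$a_1=\frac{2m\alpha-(n-2)\beta+\rho_1}{\rho_1},\qquad a_2=-\frac{\beta^2}{\rho_1},\qquad a_3=\frac{\alpha\beta(n-2)-m\alpha^2}{\rho_1^2}.$$ Then $\overline{w}$ can be extended to a function in $C^2([0,\infty))$ by setting $$\overline{w}(0)=\eta,\qquad \overline{w}_\rho(0)=\frac{a_3}{a_2}\eta^m,\qquad \overline{w}_{\rho\rho}(0)=\frac{a_3(ma_3-a_1)}{a_2^2}\eta^{2m-1}.$$ Hence, as $\rho\to 0^+$, $$\overline{w}(\rho)=\eta+\frac{a_3}{a_2}\eta^m\rho+\frac{a_3(ma_3-a_1)}{2a_2^2}\eta^{2m-1}\rho^2+o(\rho^2),$$ $$\overline{w}_\rho(\rho)=\frac{a_3}{a_2}\eta^m+\frac{a_3(ma_3-a_1)}{a_2^2}\eta^{2m-1}\rho+o(\rho),$$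 or equivalently, as $r\to 0^+$, $$f(r)=r^{-\alpha/\beta}\left\{\eta+\frac{a_3}{a_2}\eta^m r^{\rho_1/\beta'}+\frac{a_3(ma_3-a_1)}{2a_2^2}\eta^{2m-1}r^{2\rho_1/\beta'}+o(r^{2\rho_1/\beta'})\right\},$$ $$f_r(r)=r^{-\frac{\alpha}{\beta}-1}\left\{-\frac{\alpha}{\beta}\eta-\frac{(2\beta-m\rho_1)a_3}{(1-m)a_2\beta}\eta^m r^{\rho_1/\beta'}+o(r^{\rho_1/\beta'})\right\}.$$
   Context: Solutions of the elliptic equation are understood in the classical sense (positive and $C^2$ in $\mathbb{R}^n\setminus\{0\}$). Subscripts $\rho$ and $r$ denote derivatives. *)

theory Defs
  imports "HOL-Analysis.Analysis" "HOL-Library.Landau_Symbols"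
begin

definition has_partial :: "'n::finite \<Rightarrow> (real^'n \<Rightarrow> real) \<Rightarrow> real^'n \<Rightarrow> bool" where
  "has_partial i f x \<longleftrightarrow> (\<lambda>t. f (x + t *\<^sub>R axis i 1)) field_differentiable (at 0)"

definition partial :: "'n::finite \<Rightarrow> (real^'n \<Rightarrow> real) \<Rightarrow> real^'n \<Rightarrow> real" where
  "partial i f x = deriv (\<lambda>t. f (x + t *\<^sub>R axis i 1)) 0"

definition gradient :: "(real^'n::finite \<Rightarrow> real) \<Rightarrow> real^'n \<Rightarrow> real^'n" where
  "gradient f x = (\<chi> i. partial i f x)"

definition laplacian :: "(real^'n::finite \<Rightarrow> real) \<Rightarrow> real^'n \<Rightarrow> real" where
  "laplacian f x = (\<Sum>i\<in>UNIV. partial i (partial i f) x)"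

text \<open>The next two notions are intended for open sets \<open>S\<close>: all partial derivatives up to
  order one, respectively two, exist and are continuous on \<open>S\<close>.\<close>

definition C1_on :: "(real^'n::finite) set \<Rightarrow> (real^'n \<Rightarrow> real) \<Rightarrow> bool" where
  "C1_on S f \<longleftrightarrow> continuous_on S f \<and>
     (\<forall>i. (\<forall>x\<in>S. has_partial i f x) \<and> continuous_on S (partial i f))"

definition C2_on :: "(real^'n::finite) set \<Rightarrow> (real^'n \<Rightarrow> real) \<Rightarrow> bool" where
  "C2_on S f \<longleftrightarrow> C1_on S f \<and> (\<forall>i. C1_on S (partial i f))"

text \<open>Functions live on the whole space; the value at the origin is irrelevant, since every
  condition below only involves points \<open>x \<noteq> 0\<close> and their neighbourhoods.\<close>

definition elliptic_solution ::
    "real \<Rightarrow> real \<Rightarrow> real \<Rightarrow> (real^'n::finite \<Rightarrow> real) \<Rightarrow> bool" where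
  "elliptic_solution m \<alpha> \<beta> f \<longleftrightarrow>
     C2_on (- {0}) f \<and> (\<forall>x. x \<noteq> 0 \<longrightarrow> f x > 0) \<and>
     (\<forall>x. x \<noteq> 0 \<longrightarrow>
        laplacian (\<lambda>y. f y powr m / m) x + \<alpha> * f x + \<beta> * (x \<bullet> gradient f x) = 0)"

text \<open>\<open>g\<close> is \<open>C\<^sup>2\<close> on \<open>[0,\<infinity>)\<close> with first and second derivatives \<open>g1\<close>, \<open>g2\<close>; at the endpoint
  \<open>0\<close> the derivatives are one-sided.\<close>

definition C2_halfline :: "(real \<Rightarrow> real) \<Rightarrow> (real \<Rightarrow> real) \<Rightarrow> (real \<Rightarrow> real) \<Rightarrow> bool" where
  "C2_halfline g g1 g2 \<longleftrightarrow>
     (\<forall>x\<ge>0. (g has_real_derivative g1 x) (at x within {0..})) \<and>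
     (\<forall>x\<ge>0. (g1 has_real_derivative g2 x) (at x within {0..})) \<and>
     continuous_on {0..} g2"

end

theory Submission
  imports Defs
begin

(* With k = rho1/beta' and x = r^k, the radial equation for f becomes, for w = wbar and p = (w^m/m)',
     x^2 p' + a1 x p + a2 w' - a3 w^m = 0.
   Since w' = w^(1-m) p, this reads x^2 p' = (b - a1 x) p + a3 w^m with b = -a2 w^(1-m), whose limit
   at 0 is positive.  A linear equation x^2 y' = B y + G with B -> b0 > 0 and G -> g0 forces
   y -> -g0/b0: for an antiderivative H of -B/x^2, exp H blows up at 0, and l'Hopital's rule
   applies to (y exp H)/exp H.  This gives the limit of p, hence of w'.  The differentiated
   equation for p' is of the same type, with b - (a1+2) x in place of b - a1 x, and gives the limit
   of p', hence of w''.  The extension to [0,infinity) and the expansions follow from these limits. *)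

lemma has_derivative_cong_halfline:
  fixes f g :: "real \<Rightarrow> real"
  assumes "(f has_real_derivative D) (at x)" and "x > 0"
    and "\<And>y. y > 0 \<Longrightarrow> f y = g y"
  shows "(g has_real_derivative D) (at x)"
  using assms by (intro has_field_derivative_transform_within_open[OF assms(1), of "{0<..}"]) auto

lemma has_derivative_along_ray:
  assumes "has_partial i h (r *\<^sub>R axis i 1)"
  shows "((\<lambda>s. h (s *\<^sub>R axis i 1)) has_real_derivative partial i h (r *\<^sub>R axis i 1)) (at r)"
proof -
  have "((\<lambda>t. h (r *\<^sub>R axis i 1 + t *\<^sub>R axis i 1))
      has_real_derivative partial i h (r *\<^sub>R axis i 1)) (at 0)"
    using assms unfolding has_partial_def partial_def
    by (simp add: field_differentiable_derivI)
  then have "((\<lambda>t. h ((t + r) *\<^sub>R axis i 1))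
      has_real_derivative partial i h (r *\<^sub>R axis i 1)) (at 0)"
    by (simp add: scaleR_add_left add.commute)
  then show ?thesis
    using DERIV_shift[of "\<lambda>s. h (s *\<^sub>R axis i 1)" "partial i h (r *\<^sub>R axis i 1)" 0 r] by simp
qed

lemma has_derivative_norm_along_axis:
  fixes x :: "real^'n"
  assumes "x \<noteq> 0"
  shows "((\<lambda>t. norm (x + t *\<^sub>R axis i 1)) has_real_derivative x $ i / norm x) (at 0)"
proof -
  have "((\<lambda>t. norm (x + t *\<^sub>R axis i 1)) has_derivative
      (\<lambda>h. (h *\<^sub>R axis i 1) \<bullet> sgn (x + 0 *\<^sub>R axis i 1))) (at 0)"
    by (rule has_derivative_compose[OF _ has_derivative_norm])
      (use assms in \<open>auto intro!: derivative_eq_intros\<close>)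
  moreover have "(\<lambda>h. (h *\<^sub>R axis i 1) \<bullet> sgn (x + 0 *\<^sub>R axis i 1)) = (*) (x $ i / norm x)"
    by (auto simp: sgn_div_norm inner_axis' divide_inverse fun_eq_iff)
  ultimately show ?thesis
    unfolding has_field_derivative_def by simp
qed

lemma eventually_axis_line_nonzero:
  fixes x :: "real^'n"
  assumes "x \<noteq> 0"
  shows "\<forall>\<^sub>F t in nhds 0. x + t *\<^sub>R axis i 1 \<noteq> 0"
proof -
  have "((\<lambda>t. x + t *\<^sub>R axis i 1) \<longlongrightarrow> x + 0 *\<^sub>R axis i 1) (nhds 0)"
    by (intro tendsto_intros filterlim_ident)
  then have "((\<lambda>t. x + t *\<^sub>R axis i 1) \<longlongrightarrow> x) (nhds 0)"
    by simp
  then show ?thesis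
    using assms by (rule tendsto_imp_eventually_ne)
qed

lemma has_derivative_radial_along_axis:
  fixes x :: "real^'n"
  assumes "x \<noteq> 0" and "\<And>y. y \<noteq> 0 \<Longrightarrow> f y = g (norm y)"
    and "(g has_real_derivative g') (at (norm x))"
  shows "((\<lambda>t. f (x + t *\<^sub>R axis i 1)) has_real_derivative g' * (x $ i / norm x)) (at 0)"
proof -
  have "((\<lambda>t. g (norm (x + t *\<^sub>R axis i 1))) has_real_derivative g' * (x $ i / norm x)) (at 0)"
    using assms(3) by (intro DERIV_chain2 has_derivative_norm_along_axis[OF assms(1)]) simp
  moreover have "\<forall>\<^sub>F t in nhds 0. g (norm (x + t *\<^sub>R axis i 1)) = f (x + t *\<^sub>R axis i 1)"
    using eventually_axis_line_nonzero[OF assms(1), of i]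
    by eventually_elim (simp add: assms(2))
  ultimately show ?thesis
    by (subst (asm) DERIV_cong_ev[OF refl _ refl])
qed

lemma partial_radial:
  fixes x :: "real^'n"
  assumes "x \<noteq> 0" and "\<And>y. y \<noteq> 0 \<Longrightarrow> f y = g (norm y)"
    and "(g has_real_derivative g') (at (norm x))"
  shows "partial i f x = g' * (x $ i / norm x)"
  unfolding partial_def
  using has_derivative_radial_along_axis[OF assms] by (rule DERIV_imp_deriv)

lemma norm_power2_sum: "(\<Sum>i\<in>UNIV. (x $ i)\<^sup>2) = (norm x)\<^sup>2" for x :: "real^'n"
  by (simp add: norm_vec_def L2_set_def sum_nonneg)

lemma inner_gradient_radial:
  fixes x :: "real^'n"
  assumes "x \<noteq> 0" and "\<And>y. y \<noteq> 0 \<Longrightarrow> f y = g (norm y)"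
    and "(g has_real_derivative g') (at (norm x))"
  shows "x \<bullet> gradient f x = norm x * g'"
proof -
  have "x \<bullet> gradient f x = (\<Sum>i\<in>UNIV. (x $ i)\<^sup>2) * (g' / norm x)"
    unfolding inner_vec_def gradient_def sum_distrib_right
    by (simp add: partial_radial[OF assms] power2_eq_square mult_ac)
  with assms(1) show ?thesis
    by (simp only: norm_power2_sum) (simp add: power2_eq_square)
qed

lemma laplacian_radial:
  fixes x :: "real^'n"
  assumes x: "x \<noteq> 0" and f: "\<And>y. y \<noteq> 0 \<Longrightarrow> f y = g (norm y)"
    and g1: "\<And>r. r > 0 \<Longrightarrow> (g has_real_derivative g1 r) (at r)"
    and g2: "(g1 has_real_derivative g2) (at (norm x))"
  shows "laplacian f x = g2 + (real CARD('n) - 1) / norm x * g1 (norm x)"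
proof -
  let ?r = "norm x"
  have r: "?r > 0" using x by simp
  have "partial i (partial i f) x = (g2 / ?r\<^sup>2 - g1 ?r / ?r ^ 3) * (x $ i)\<^sup>2 + g1 ?r / ?r" for i
  proof -
    have ev: "\<forall>\<^sub>F t in nhds 0. partial i f (x + t *\<^sub>R axis i 1)
        = g1 (norm (x + t *\<^sub>R axis i 1)) * ((x $ i + t) / norm (x + t *\<^sub>R axis i 1))"
      using eventually_axis_line_nonzero[OF x]
      by eventually_elim (subst partial_radial[OF _ f g1], auto)
    have "((\<lambda>t. g1 (norm (x + t *\<^sub>R axis i 1))) has_real_derivative g2 * (x $ i / ?r)) (at 0)"
      using g2 by (intro DERIV_chain2 has_derivative_norm_along_axis[OF x]) simp
    then have "((\<lambda>t. g1 (norm (x + t *\<^sub>R axis i 1)) * ((x $ i + t) / norm (x + t *\<^sub>R axis i 1)))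
      has_real_derivative (g2 * (x $ i / ?r)) * (x $ i / ?r) +
          (?r - x $ i * (x $ i / ?r)) / (?r * ?r) * g1 ?r) (at 0)"
      by (rule DERIV_cong[OF DERIV_mult[OF _ DERIV_divide
              [OF DERIV_add[OF DERIV_const DERIV_ident] has_derivative_norm_along_axis[OF x]]]])
        (use x in simp_all)
    then have "partial i (partial i f) x = (g2 * (x $ i / ?r)) * (x $ i / ?r) +
          (?r - x $ i * (x $ i / ?r)) / (?r * ?r) * g1 ?r"
      unfolding partial_def[of i "partial i f"] deriv_cong_ev[OF ev refl]
      by (rule DERIV_imp_deriv)
    also have "\<dots> = (g2 / ?r\<^sup>2 - g1 ?r / ?r ^ 3) * (x $ i)\<^sup>2 + g1 ?r / ?r"
      using r by (simp add: field_simps power2_eq_square power3_eq_cube)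
    finally show ?thesis .
  qed
  then have "laplacian f x
      = (g2 / ?r\<^sup>2 - g1 ?r / ?r ^ 3) * ?r\<^sup>2 + real CARD('n) * (g1 ?r / ?r)"
    unfolding laplacian_def
    by (simp add: sum.distrib flip: sum_distrib_left norm_power2_sum)
  also have "\<dots> = g2 + (real CARD('n) - 1) / ?r * g1 ?r"
    using r by (simp add: divide_simps) (simp add: algebra_simps eval_nat_numeral)
  finally show ?thesis .
qed

lemma antiderivative_halfline:
  fixes h :: "real \<Rightarrow> real"
  assumes "continuous_on {0<..} h"
  obtains H where "\<And>x. x > 0 \<Longrightarrow> (H has_real_derivative h x) (at x)"
proof -
  define H where "H x = (if x < 1 then - integral {x..1} h else integral {1..x} h)" for x
  have "(H has_real_derivative h x) (at x)" if x: "x > 0" for x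
  proof -
    define a where "a = min x 1 / 2"
    define b where "b = max x 1 + 1"
    have ab: "0 < a" "a < x" "x < b" "a < 1" "1 < b" using x by (auto simp: a_def b_def)
    have cont: "continuous_on {a..b} h"
      using ab by (intro continuous_on_subset[OF assms]) auto
    have int: "h integrable_on {c..d}" if "a \<le> c" "d \<le> b" for c d
      using that by (intro integrable_continuous_interval continuous_on_subset[OF cont]) auto
    have eq: "H y = integral {a..y} h - integral {a..1} h" if "y \<in> {a<..<b}" for y
      using that ab
        Henstock_Kurzweil_Integration.integral_combine[of a y 1 h]
        Henstock_Kurzweil_Integration.integral_combine[of a 1 y h] int[of a 1] int[of a y]
      by (auto simp: H_def)
    have "((\<lambda>y. integral {a..y} h) has_real_derivative h x) (at x within {a..b})"
      using ab by (intro integral_has_real_derivative[OF cont]) auto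
    then have "((\<lambda>y. integral {a..y} h) has_real_derivative h x) (at x)"
      using ab by (simp add: at_within_Icc_at)
    then have "((\<lambda>y. integral {a..y} h - integral {a..1} h) has_real_derivative h x) (at x)"
      by (auto intro!: derivative_eq_intros)
    then show ?thesis
      by (rule has_field_derivative_transform_within_open[where S = "{a<..<b}"])
        (use ab in \<open>auto simp: eq\<close>)
  qed
  then show ?thesis by (rule that)
qed

text \<open>The solution of the homogeneous equation is \<open>exp (- (b + o(1)) / x)\<close> at \<open>0\<close>, so no initial
  condition is needed: \<^emph>\<open>every\<close> solution has the same limit.\<close>

lemma singular_linear_ode_limit:
  fixes y y' B G :: "real \<Rightarrow> real"
  assumes y: "\<And>x. x > 0 \<Longrightarrow> (y has_real_derivative y' x) (at x)"
    and ode: "\<And>x. x > 0 \<Longrightarrow> x\<^sup>2 * y' x = B x * y x + G x"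
    and B: "continuous_on {0<..} B" "(B \<longlongrightarrow> b) (at_right 0)" "b > 0"
    and G: "(G \<longlongrightarrow> g) (at_right 0)"
  shows "(y \<longlongrightarrow> - (g / b)) (at_right 0)"
proof -
  obtain H where H: "\<And>x. x > 0 \<Longrightarrow> (H has_real_derivative - (B x / x\<^sup>2)) (at x)"
  proof -
    have "continuous_on {0<..} (\<lambda>x. - (B x / x\<^sup>2))"
      using B(1) by (intro continuous_intros) auto
    with that show ?thesis
      using antiderivative_halfline by blast
  qed
  have pos: "\<forall>\<^sub>F x in at_right 0. (0::real) < x"
    by (rule eventually_at_right_less)
  have "((\<lambda>x. H x / (1 / x)) \<longlongrightarrow> b) (at_right 0)"
  proof (rule lhopital_right_0_at_top)
    show "LIM x at_right 0. (1::real) / x :> at_top"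
      using filterlim_inverse_at_top_right by (simp add: divide_inverse)
    show "\<forall>\<^sub>F x in at_right 0. (H has_real_derivative - (B x / x\<^sup>2)) (at x)"
      using pos by eventually_elim (rule H)
    show "\<forall>\<^sub>F x in at_right 0. ((\<lambda>x. 1 / x) has_real_derivative - (1 / x\<^sup>2)) (at x)"
      using pos by eventually_elim (auto intro!: derivative_eq_intros simp: power2_eq_square)
    show "\<forall>\<^sub>F x in at_right 0. - (1 / x\<^sup>2) \<noteq> (0::real)"
      using pos by eventually_elim simp
    have "\<forall>\<^sub>F x in at_right 0. B x = - (B x / x\<^sup>2) / - (1 / x\<^sup>2)"
      using pos by eventually_elim simp
    then show "((\<lambda>x. - (B x / x\<^sup>2) / - (1 / x\<^sup>2)) \<longlongrightarrow> b) (at_right 0)"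
      using B(2) by (rule Lim_transform_eventually[rotated])
  qed
  then have "LIM x at_right 0. (H x / (1 / x)) * (1 / x) :> at_top"
    by (rule filterlim_tendsto_pos_mult_at_top[OF _ B(3)])
      (use filterlim_inverse_at_top_right in \<open>simp add: divide_inverse\<close>)
  moreover have "\<forall>\<^sub>F x in at_right 0. (H x / (1 / x)) * (1 / x) = H x"
    using pos by eventually_elim simp
  ultimately have "LIM x at_right 0. H x :> at_top"
    by (simp cong: filterlim_cong)
  then have top: "LIM x at_right 0. exp (H x) :> at_top"
    by (rule filterlim_compose[OF exp_at_top])
  have "\<forall>\<^sub>F x in at_right 0. B x > 0"
    using B(2,3) by (rule order_tendstoD)
  with pos have pos2: "\<forall>\<^sub>F x in at_right 0. x > 0 \<and> B x > 0"
    by eventually_elim simp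
  have "((\<lambda>x. (y x * exp (H x)) / exp (H x)) \<longlongrightarrow> - (g / b)) (at_right 0)"
  proof (rule lhopital_right_0_at_top[OF top])
    have "((\<lambda>x. y x * exp (H x)) has_real_derivative G x / x\<^sup>2 * exp (H x)) (at x)" if "x > 0" for x
    proof -
      have "((\<lambda>x. y x * exp (H x)) has_real_derivative
          y' x * exp (H x) + exp (H x) * - (B x / x\<^sup>2) * y x) (at x)"
        using that by (auto intro!: derivative_eq_intros y H)
      moreover have "y' x = (B x * y x + G x) / x\<^sup>2"
        using ode[OF that] that by (simp add: field_simps)
      ultimately show ?thesis
        by (simp add: algebra_simps add_divide_distrib)
    qed
    then show "\<forall>\<^sub>F x in at_right 0.
        ((\<lambda>x. y x * exp (H x)) has_real_derivative G x / x\<^sup>2 * exp (H x)) (at x)"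
      by (intro eventually_mono[OF pos])
    show "\<forall>\<^sub>F x in at_right 0.
        ((\<lambda>x. exp (H x)) has_real_derivative - (B x / x\<^sup>2) * exp (H x)) (at x)"
      using pos by eventually_elim (auto intro!: derivative_eq_intros H)
    show "\<forall>\<^sub>F x in at_right 0. - (B x / x\<^sup>2) * exp (H x) \<noteq> 0"
      using pos2 by eventually_elim simp
    have "((\<lambda>x. - (G x / B x)) \<longlongrightarrow> - (g / b)) (at_right 0)"
      using B(2,3) G by (intro tendsto_intros) auto
    moreover have "\<forall>\<^sub>F x in at_right 0. - (G x / B x) =
        (G x / x\<^sup>2 * exp (H x)) / (- (B x / x\<^sup>2) * exp (H x))"
      using pos2 by eventually_elim (simp add: field_simps)
    ultimately show "((\<lambda>x. (G x / x\<^sup>2 * exp (H x)) / (- (B x / x\<^sup>2) * exp (H x)))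
        \<longlongrightarrow> - (g / b)) (at_right 0)"
      by (rule Lim_transform_eventually)
  qed
  then show ?thesis by simp
qed

lemma has_derivative_right_0_of_limit:
  fixes g g' :: "real \<Rightarrow> real"
  assumes g: "\<And>x. x > 0 \<Longrightarrow> (g has_real_derivative g' x) (at x)"
    and lim: "(g \<longlongrightarrow> c) (at_right 0)" "(g' \<longlongrightarrow> l) (at_right 0)"
  shows "((\<lambda>x. (g x - c) / x) \<longlongrightarrow> l) (at_right 0)"
proof -
  have pos: "\<forall>\<^sub>F x in at_right 0. (0::real) < x"
    by (rule eventually_at_right_less)
  show ?thesis
  proof (rule lhopital_right_0[where f' = g' and g' = "\<lambda>_. 1"])
    show "((\<lambda>x. g x - c) \<longlongrightarrow> 0) (at_right 0)"
      using tendsto_diff[OF lim(1) tendsto_const[of c]] by simp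
    show "\<forall>\<^sub>F x in at_right 0. ((\<lambda>x. g x - c) has_real_derivative g' x) (at x)"
      using pos by eventually_elim (auto intro!: derivative_eq_intros g)
  qed (use lim pos in \<open>auto elim: eventually_mono\<close>)
qed

lemma has_derivative_halfline_extension:
  fixes g g' :: "real \<Rightarrow> real"
  assumes g: "\<And>x. x > 0 \<Longrightarrow> (g has_real_derivative g' x) (at x)"
    and lim: "(g \<longlongrightarrow> c) (at_right 0)" "(g' \<longlongrightarrow> l) (at_right 0)"
    and x: "x \<ge> 0"
  shows "((g(0 := c)) has_real_derivative (g'(0 := l)) x) (at x within {0..})"
proof (cases "x = 0")
  case True
  have "((\<lambda>x. (g x - c) / x) \<longlongrightarrow> l) (at_right 0)"
    using has_derivative_right_0_of_limit[OF g lim] .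
  moreover have "\<forall>\<^sub>F x in at_right 0. (g x - c) / x = ((g(0 := c)) x - (g(0 := c)) 0) / (x - 0)"
    using eventually_at_right_less[of "0::real"] by eventually_elim simp
  ultimately have "((\<lambda>x. ((g(0 := c)) x - (g(0 := c)) 0) / (x - 0)) \<longlongrightarrow> l) (at_right 0)"
    by (rule Lim_transform_eventually)
  then show ?thesis
    using True by (simp add: has_field_derivative_iff at_within_Ici_at_right)
next
  case False
  with x have x: "x > 0" by simp
  have "((g(0 := c)) has_real_derivative g' x) (at x)"
    using g[OF x] x by (rule has_derivative_cong_halfline) auto
  then show ?thesis
    using x by (auto intro: has_field_derivative_at_within)
qed

lemma C2_halfline_extension:
  assumes g: "\<And>x. x > 0 \<Longrightarrow> (g has_real_derivative g1 x) (at x)"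
    and g1: "\<And>x. x > 0 \<Longrightarrow> (g1 has_real_derivative g2 x) (at x)"
    and g2: "continuous_on {0<..} g2"
    and lim: "(g \<longlongrightarrow> c0) (at_right 0)" "(g1 \<longlongrightarrow> c1) (at_right 0)" "(g2 \<longlongrightarrow> c2) (at_right 0)"
  shows "C2_halfline (g(0 := c0)) (g1(0 := c1)) (g2(0 := c2))"
  unfolding C2_halfline_def
proof (intro conjI allI impI)
  show "continuous_on {0..} (g2(0 := c2))"
    unfolding continuous_on_eq_continuous_within
  proof
    fix x :: real assume "x \<in> {0..}"
    show "continuous (at x within {0..}) (g2(0 := c2))"
    proof (cases "x = 0")
      case True
      have "\<forall>\<^sub>F x in at_right 0. g2 x = (g2(0 := c2)) x"
        using eventually_at_right_less[of "0::real"] by eventually_elim simp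
      with lim(3) have "(g2(0 := c2) \<longlongrightarrow> c2) (at_right 0)"
        by (rule Lim_transform_eventually)
      with True show ?thesis
        by (simp add: continuous_within at_within_Ici_at_right)
    next
      case False
      then have x: "x > 0" using \<open>x \<in> {0..}\<close> by simp
      have "isCont g2 x"
        using g2 x by (simp add: continuous_on_eq_continuous_at)
      moreover have "\<forall>\<^sub>F y in nhds x. g2 y = (g2(0 := c2)) y"
        using x by (intro eventually_mono[OF eventually_nhds_in_open[of "{0<..}" x]]) auto
      ultimately have "isCont (g2(0 := c2)) x"
        using isCont_cong by blast
      then show ?thesis by (rule continuous_at_imp_continuous_at_within)
    qed
  qed
qed (use has_derivative_halfline_extension[OF g lim(1,2)]
      has_derivative_halfline_extension[OF g1 lim(2,3)] in auto)

lemma taylor1_right_0: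
  fixes g g' :: "real \<Rightarrow> real"
  assumes g: "\<And>x. x > 0 \<Longrightarrow> (g has_real_derivative g' x) (at x)"
    and lim: "(g \<longlongrightarrow> c) (at_right 0)" "(g' \<longlongrightarrow> l) (at_right 0)"
  shows "(\<lambda>x. g x - (c + l * x)) \<in> o[at_right 0](\<lambda>x. x)"
proof (rule smalloI_tendsto)
  have "((\<lambda>x. (g x - c) / x - l) \<longlongrightarrow> l - l) (at_right 0)"
    by (intro tendsto_intros has_derivative_right_0_of_limit[OF g lim])
  moreover have "\<forall>\<^sub>F x in at_right 0. (g x - c) / x - l = (g x - (c + l * x)) / x"
    using eventually_at_right_less[of "0::real"] by eventually_elim (simp add: field_simps)
  ultimately show "((\<lambda>x. (g x - (c + l * x)) / x) \<longlongrightarrow> 0) (at_right 0)"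
    using Lim_transform_eventually by fastforce
  show "\<forall>\<^sub>F x in at_right 0. x \<noteq> (0::real)"
    using eventually_at_right_less[of "0::real"] by eventually_elim simp
qed

lemma taylor2_right_0:
  fixes g g1 g2 :: "real \<Rightarrow> real"
  assumes g: "\<And>x. x > 0 \<Longrightarrow> (g has_real_derivative g1 x) (at x)"
    and g1: "\<And>x. x > 0 \<Longrightarrow> (g1 has_real_derivative g2 x) (at x)"
    and lim: "(g \<longlongrightarrow> c0) (at_right 0)" "(g1 \<longlongrightarrow> c1) (at_right 0)" "(g2 \<longlongrightarrow> c2) (at_right 0)"
  shows "(\<lambda>x. g x - (c0 + c1 * x + c2 / 2 * x\<^sup>2)) \<in> o[at_right 0](\<lambda>x. x\<^sup>2)"
proof (rule smalloI_tendsto)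
  have pos: "\<forall>\<^sub>F x in at_right 0. (0::real) < x"
    by (rule eventually_at_right_less)
  show ne: "\<forall>\<^sub>F x in at_right 0. x\<^sup>2 \<noteq> (0::real)"
    using pos by eventually_elim simp
  show "((\<lambda>x. (g x - (c0 + c1 * x + c2 / 2 * x\<^sup>2)) / x\<^sup>2) \<longlongrightarrow> 0) (at_right 0)"
  proof (rule lhopital_right_0)
    have "((\<lambda>x. g x - (c0 + c1 * x + c2 / 2 * x\<^sup>2)) \<longlongrightarrow> c0 - (c0 + c1 * 0 + c2 / 2 * 0\<^sup>2))
        (at_right 0)"
      by (intro tendsto_intros lim)
    then show "((\<lambda>x. g x - (c0 + c1 * x + c2 / 2 * x\<^sup>2)) \<longlongrightarrow> 0) (at_right 0)" by simp
    show "((\<lambda>x. x\<^sup>2) \<longlongrightarrow> (0::real)) (at_right 0)"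
      by (auto intro!: tendsto_eq_intros)
    show "\<forall>\<^sub>F x in at_right 0. 2 * x \<noteq> (0::real)"
      using pos by eventually_elim simp
    show "\<forall>\<^sub>F x in at_right 0. ((\<lambda>x. g x - (c0 + c1 * x + c2 / 2 * x\<^sup>2))
        has_real_derivative g1 x - (c1 + c2 * x)) (at x)"
      using pos by eventually_elim (auto intro!: derivative_eq_intros g)
    show "\<forall>\<^sub>F x in at_right 0. ((\<lambda>x. x\<^sup>2) has_real_derivative 2 * x) (at (x::real))"
      by (auto intro!: derivative_eq_intros always_eventually)
    have "((\<lambda>x. (g1 x - (c1 + c2 * x)) / x) \<longlongrightarrow> 0) (at_right 0)"
      by (rule smalloD_tendsto[OF taylor1_right_0[OF g1 lim(2,3)]])
    then have "((\<lambda>x. (g1 x - (c1 + c2 * x)) / x / 2) \<longlongrightarrow> 0 / 2) (at_right 0)"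
      by (intro tendsto_intros) auto
    then show "((\<lambda>x. (g1 x - (c1 + c2 * x)) / (2 * x)) \<longlongrightarrow> 0) (at_right 0)"
      by (simp add: field_simps)
  qed (rule ne)
qed

lemma degenerate_ode_limits:
  fixes w w1 q :: "real \<Rightarrow> real"
  assumes pos: "\<And>x. x > 0 \<Longrightarrow> w x > 0"
    and w: "\<And>x. x > 0 \<Longrightarrow> (w has_real_derivative w1 x) (at x)"
    and p: "\<And>x. x > 0 \<Longrightarrow> ((\<lambda>x. w x powr (m - 1) * w1 x) has_real_derivative q x) (at x)"
    and ode: "\<And>x. x > 0 \<Longrightarrow>
      x\<^sup>2 * q x + a1 * x * (w x powr (m - 1) * w1 x) + a2 * w1 x - a3 * w x powr m = 0"
    and lim: "(w \<longlongrightarrow> \<eta>) (at_right 0)" and \<eta>: "\<eta> > 0" and a2: "a2 < 0"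
  obtains w2 where "\<And>x. x > 0 \<Longrightarrow> (w1 has_real_derivative w2 x) (at x)"
    and "continuous_on {0<..} w2"
    and "(w1 \<longlongrightarrow> a3 / a2 * \<eta> powr m) (at_right 0)"
    and "(w2 \<longlongrightarrow> a3 * (m * a3 - a1) / a2\<^sup>2 * \<eta> powr (2 * m - 1)) (at_right 0)"
proof -
  define p where "p x = w x powr (m - 1) * w1 x" for x
  define b where "b x = - a2 * w x powr (1 - m)" for x
  define g where "g x = a3 * w x powr m" for x
  define b1 where "b1 x = - a2 * (1 - m) * w x powr (- m) * w1 x" for x
  define Q where "Q x = ((b x - (a1 + 2) * x) * q x + ((b1 x - a1) * p x + a3 * m * p x)) / x\<^sup>2" for x
  define w2 where "w2 x = (1 - m) * w x powr (- m) * w1 x * p x + w x powr (1 - m) * q x" for x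
  have w1_eq: "w1 x = w x powr (1 - m) * p x" if "x > 0" for x
    using pos[OF that] by (simp add: p_def flip: mult.assoc powr_add)
  have dp: "(p has_real_derivative q x) (at x)" if "x > 0" for x
    using p[OF that] by (simp add: p_def[abs_def])
  have dpow: "((\<lambda>x. w x powr s) has_real_derivative s * w x powr (s - 1) * w1 x) (at x)"
    if "x > 0" for x s
    using DERIV_fun_powr[OF w pos, OF that that, of s] by simp
  have db: "(b has_real_derivative b1 x) (at x)" if "x > 0" for x
    using DERIV_cmult[OF dpow[OF that, of "1 - m"], of "- a2"]
    by (simp add: b_def[abs_def] b1_def mult_ac)
  have dg: "(g has_real_derivative a3 * m * p x) (at x)" if "x > 0" for x
    using DERIV_cmult[OF dpow[OF that, of m], of a3] by (simp add: g_def[abs_def] p_def mult_ac)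
  have q_ode: "x\<^sup>2 * q x = (b x - a1 * x) * p x + g x" if "x > 0" for x
  proof -
    have "x\<^sup>2 * q x + a1 * x * p x + a2 * w1 x - a3 * w x powr m = 0"
      using ode[OF that] by (simp add: p_def)
    then show ?thesis
      by (simp add: w1_eq[OF that] b_def g_def algebra_simps)
  qed
  have q_eq: "q x = ((b x - a1 * x) * p x + g x) / x\<^sup>2" if "x > 0" for x
    using q_ode[OF that] that by (simp add: field_simps)
  have dq: "(q has_real_derivative Q x) (at x)" if x: "x > 0" for x
  proof -
    have "((\<lambda>x. (b x - a1 * x) * p x + g x) has_real_derivative
        (b1 x - a1) * p x + q x * (b x - a1 * x) + a3 * m * p x) (at x)"
      using DERIV_add[OF DERIV_mult[OF DERIV_diff[OF db DERIV_cmult_Id] dp] dg, OF x x x] .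
    from DERIV_divide[OF this DERIV_pow[of 2]] x
    have "((\<lambda>x. ((b x - a1 * x) * p x + g x) / x\<^sup>2) has_real_derivative
        (((b1 x - a1) * p x + q x * (b x - a1 * x) + a3 * m * p x) * x\<^sup>2
          - (x\<^sup>2 * q x) * (2 * x)) / (x\<^sup>2 * x\<^sup>2)) (at x)"
      by (simp add: q_ode[OF x])
    also have "(((b1 x - a1) * p x + q x * (b x - a1 * x) + a3 * m * p x) * x\<^sup>2
          - (x\<^sup>2 * q x) * (2 * x)) / (x\<^sup>2 * x\<^sup>2) = Q x"
      using x by (simp add: Q_def divide_simps) (simp add: algebra_simps)
    finally have "((\<lambda>x. ((b x - a1 * x) * p x + g x) / x\<^sup>2)
        has_real_derivative Q x) (at x)" .
    then show ?thesis
      by (rule has_derivative_cong_halfline) (use x in \<open>auto simp: q_eq\<close>)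
  qed
  have dw1: "(w1 has_real_derivative w2 x) (at x)" if x: "x > 0" for x
  proof -
    have "((\<lambda>x. w x powr (1 - m) * p x) has_real_derivative w2 x) (at x)"
      using DERIV_mult[OF dpow[OF x, of "1 - m"] dp[OF x]] by (simp add: w2_def mult_ac)
    then show ?thesis
      by (rule has_derivative_cong_halfline) (use x in \<open>auto simp: w1_eq\<close>)
  qed
  have cont: "continuous_on {0<..} w" "continuous_on {0<..} w1" "continuous_on {0<..} p"
    "continuous_on {0<..} q" "continuous_on {0<..} b"
    using w dw1 dp dq db
    by (force intro: DERIV_continuous_on[OF has_field_derivative_at_within])+
  have cont2: "continuous_on {0<..} w2"
    unfolding w2_def using pos by (intro continuous_intros cont) (auto simp: less_imp_neq[symmetric])

  define b0 where "b0 = - a2 * \<eta> powr (1 - m)"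
  have b0: "b0 > 0" using a2 \<eta> by (simp add: b0_def mult_neg_pos)
  have lim_pow: "((\<lambda>x. w x powr s) \<longlongrightarrow> \<eta> powr s) (at_right 0)" for s
    using lim \<eta> by (intro tendsto_intros) auto
  have lim_b: "((\<lambda>x. b x - c * x) \<longlongrightarrow> b0) (at_right 0)" for c
  proof -
    have "((\<lambda>x. - a2 * w x powr (1 - m) - c * x) \<longlongrightarrow> b0 - c * 0) (at_right 0)"
      unfolding b0_def by (intro tendsto_intros lim_pow)
    then show ?thesis by (simp add: b_def)
  qed
  have lim_p: "(p \<longlongrightarrow> a3 / a2 * \<eta> powr (2 * m - 1)) (at_right 0)"
  proof -
    have "(p \<longlongrightarrow> - (a3 * \<eta> powr m / b0)) (at_right 0)"
    proof (rule singular_linear_ode_limit[OF dp q_ode _ lim_b b0])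
      show "continuous_on {0<..} (\<lambda>x. b x - a1 * x)"
        by (intro continuous_intros cont)
      show "(g \<longlongrightarrow> a3 * \<eta> powr m) (at_right 0)"
        unfolding g_def by (intro tendsto_intros lim_pow)
    qed
    also have "- (a3 * \<eta> powr m / b0) = a3 / a2 * (\<eta> powr m / \<eta> powr (1 - m))"
      by (simp add: b0_def)
    also have "\<eta> powr m / \<eta> powr (1 - m) = \<eta> powr (2 * m - 1)"
      by (simp flip: powr_diff)
    finally show ?thesis .
  qed
  have lim_w1: "(w1 \<longlongrightarrow> a3 / a2 * \<eta> powr m) (at_right 0)"
  proof (rule Lim_transform_eventually)
    have "((\<lambda>x. w x powr (1 - m) * p x) \<longlongrightarrow> \<eta> powr (1 - m) * (a3 / a2 * \<eta> powr (2 * m - 1)))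
        (at_right 0)"
      by (intro tendsto_intros lim_pow lim_p)
    also have "\<eta> powr (1 - m) * (a3 / a2 * \<eta> powr (2 * m - 1))
        = a3 / a2 * (\<eta> powr (1 - m) * \<eta> powr (2 * m - 1))"
      by (simp only: mult_ac)
    also have "\<eta> powr (1 - m) * \<eta> powr (2 * m - 1) = \<eta> powr m"
      by (simp flip: powr_add)
    finally show "((\<lambda>x. w x powr (1 - m) * p x) \<longlongrightarrow> a3 / a2 * \<eta> powr m) (at_right 0)" .
    show "\<forall>\<^sub>F x in at_right 0. w x powr (1 - m) * p x = w1 x"
      using eventually_at_right_less[of "0::real"] by eventually_elim (simp add: w1_eq)
  qed
  have lim_b1: "(b1 \<longlongrightarrow> - (1 - m) * a3) (at_right 0)"
  proof -
    have "(b1 \<longlongrightarrow> - a2 * (1 - m) * \<eta> powr (- m) * (a3 / a2 * \<eta> powr m)) (at_right 0)"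
      unfolding b1_def by (intro tendsto_intros lim_pow lim_w1)
    also have "- a2 * (1 - m) * \<eta> powr (- m) * (a3 / a2 * \<eta> powr m)
        = - (1 - m) * a3 * (\<eta> powr (- m) * \<eta> powr m)"
      using a2 by (simp add: algebra_simps)
    also have "\<eta> powr (- m) * \<eta> powr m = 1"
      using \<eta> by (simp flip: powr_add)
    finally show ?thesis by simp
  qed
  have lim_q: "(q \<longlongrightarrow> a3 * (m * a3 - a1 - (1 - m) * a3) / a2\<^sup>2 * \<eta> powr (3 * m - 2)) (at_right 0)"
  proof -
    let ?p0 = "a3 / a2 * \<eta> powr (2 * m - 1)"
    have "(q \<longlongrightarrow> - (((- (1 - m) * a3 - a1) * ?p0 + a3 * m * ?p0) / b0)) (at_right 0)"
    proof (rule singular_linear_ode_limit[OF dq _ _ lim_b b0])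
      show "x\<^sup>2 * Q x = (b x - (a1 + 2) * x) * q x + ((b1 x - a1) * p x + a3 * m * p x)"
        if "x > 0" for x
        using that by (simp add: Q_def)
      show "continuous_on {0<..} (\<lambda>x. b x - (a1 + 2) * x)"
        by (intro continuous_intros cont)
      show "((\<lambda>x. (b1 x - a1) * p x + a3 * m * p x)
          \<longlongrightarrow> (- (1 - m) * a3 - a1) * ?p0 + a3 * m * ?p0) (at_right 0)"
        by (intro tendsto_intros lim_p lim_b1)
    qed
    moreover have "- (((- (1 - m) * a3 - a1) * (a3 / a2 * X) + a3 * m * (a3 / a2 * X)) / (- a2 * Y))
        = a3 * (m * a3 - a1 - (1 - m) * a3) / a2\<^sup>2 * (X / Y)" for X Y
      using a2 by (simp add: power2_eq_square field_simps)
    moreover have "\<eta> powr (2 * m - 1) / \<eta> powr (1 - m) = \<eta> powr (3 * m - 2)"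
      by (simp flip: powr_diff)
    ultimately show ?thesis unfolding b0_def by metis
  qed
  have "(w2 \<longlongrightarrow> (1 - m) * \<eta> powr (- m) * (a3 / a2 * \<eta> powr m) * (a3 / a2 * \<eta> powr (2 * m - 1))
      + \<eta> powr (1 - m) * (a3 * (m * a3 - a1 - (1 - m) * a3) / a2\<^sup>2 * \<eta> powr (3 * m - 2))) (at_right 0)"
    unfolding w2_def by (intro tendsto_intros lim_pow lim_w1 lim_p lim_q)
  also have "(1 - m) * \<eta> powr (- m) * (a3 / a2 * \<eta> powr m) * (a3 / a2 * \<eta> powr (2 * m - 1))
      + \<eta> powr (1 - m) * (a3 * (m * a3 - a1 - (1 - m) * a3) / a2\<^sup>2 * \<eta> powr (3 * m - 2))
    = (1 - m) * (\<eta> powr (- m) * \<eta> powr m) * (a3 / a2 * (a3 / a2)) * \<eta> powr (2 * m - 1)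
      + a3 * (m * a3 - a1 - (1 - m) * a3) / a2\<^sup>2 * (\<eta> powr (1 - m) * \<eta> powr (3 * m - 2))"
    by (simp only: mult_ac)
  also have "\<eta> powr (- m) * \<eta> powr m = 1"
    using \<eta> by (simp flip: powr_add)
  also have "\<eta> powr (1 - m) * \<eta> powr (3 * m - 2) = \<eta> powr (2 * m - 1)"
    by (simp flip: powr_add)
  also have "(1 - m) * 1 * (a3 / a2 * (a3 / a2)) * \<eta> powr (2 * m - 1)
      + a3 * (m * a3 - a1 - (1 - m) * a3) / a2\<^sup>2 * \<eta> powr (2 * m - 1)
    = a3 * (m * a3 - a1) / a2\<^sup>2 * \<eta> powr (2 * m - 1)"
    using a2 by (simp add: divide_simps power2_eq_square) (simp add: algebra_simps)
  finally show thesis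
    using that dw1 cont2 lim_w1 by blast
qed

lemma radial_profile_equation:
  fixes f :: "real^'n \<Rightarrow> real" and fr :: "real \<Rightarrow> real"
  assumes sol: "elliptic_solution m \<alpha> \<beta> f"
    and radial: "\<And>x. x \<noteq> 0 \<Longrightarrow> f x = fr (norm x)" and m: "m \<noteq> 0"
  obtains f1 u2 where "\<And>r. r > 0 \<Longrightarrow> fr r > 0"
    and "\<And>r. r > 0 \<Longrightarrow> (fr has_real_derivative f1 r) (at r)"
    and "\<And>r. r > 0 \<Longrightarrow> ((\<lambda>r. fr r powr (m - 1) * f1 r) has_real_derivative u2 r) (at r)"
    and "\<And>r. r > 0 \<Longrightarrow> u2 r + (real CARD('n) - 1) / r * (fr r powr (m - 1) * f1 r)
      + \<alpha> * fr r + \<beta> * r * f1 r = 0"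
proof -
  obtain i :: 'n where True by simp
  define e :: "real \<Rightarrow> real^'n" where "e r = r *\<^sub>R axis i 1" for r
  have e: "e r \<noteq> 0" "norm (e r) = r" if "r > 0" for r
    using that by (auto simp: e_def)
  define f1 where "f1 r = partial i f (e r)" for r
  define f2 where "f2 r = partial i (partial i f) (e r)" for r
  define u2 where "u2 r = (m - 1) * fr r powr (m - 2) * f1 r * f1 r + fr r powr (m - 1) * f2 r" for r
  have pos: "fr r > 0" if "r > 0" for r
    using sol radial[of "e r"] e[OF that] by (auto simp: elliptic_solution_def)
  have has: "has_partial i f x" "has_partial i (partial i f) x" if "x \<noteq> 0" for x
    using sol that by (auto simp: elliptic_solution_def C2_on_def C1_on_def)
  have d1: "(fr has_real_derivative f1 r) (at r)" if r: "r > 0" for r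
  proof -
    have "((\<lambda>s. f (e s)) has_real_derivative f1 r) (at r)"
      unfolding f1_def e_def using e(1)[OF r]
      by (intro has_derivative_along_ray has) (simp add: e_def)
    then show ?thesis
      by (rule has_derivative_cong_halfline) (use r in \<open>auto simp: radial e\<close>)
  qed
  have d2: "(f1 has_real_derivative f2 r) (at r)" if r: "r > 0" for r
    unfolding f1_def[abs_def] f2_def e_def using e(1)[OF r]
    by (intro has_derivative_along_ray has) (simp add: e_def)
  have dpow: "((\<lambda>r. fr r powr s) has_real_derivative s * fr r powr (s - 1) * f1 r) (at r)"
    if "r > 0" for r s
    using DERIV_fun_powr[OF d1 pos, OF that that, of s] by simp
  have du: "((\<lambda>r. fr r powr m / m) has_real_derivative fr r powr (m - 1) * f1 r) (at r)"
    if "r > 0" for r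
    using DERIV_cdivide[OF dpow[OF that, of m], of m] m by simp
  have du2: "((\<lambda>r. fr r powr (m - 1) * f1 r) has_real_derivative u2 r) (at r)" if "r > 0" for r
    using DERIV_mult[OF dpow[OF that, of "m - 1"] d2[OF that]] by (simp add: u2_def mult_ac)
  have "u2 r + (real CARD('n) - 1) / r * (fr r powr (m - 1) * f1 r) + \<alpha> * fr r + \<beta> * r * f1 r = 0"
    if r: "r > 0" for r
  proof -
    note er = e[OF r]
    have "laplacian (\<lambda>y. f y powr m / m) (e r) + \<alpha> * f (e r) + \<beta> * (e r \<bullet> gradient f (e r)) = 0"
      using sol er(1) by (auto simp: elliptic_solution_def)
    moreover have "laplacian (\<lambda>y. f y powr m / m) (e r)
        = u2 r + (real CARD('n) - 1) / norm (e r) * (fr (norm (e r)) powr (m - 1) * f1 (norm (e r)))"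
      by (rule laplacian_radial[OF er(1) _ du]) (use r in \<open>simp_all add: radial er du2\<close>)
    moreover have "e r \<bullet> gradient f (e r) = norm (e r) * f1 r"
      by (rule inner_gradient_radial[where g = fr]) (use r in \<open>simp_all add: radial er d1\<close>)
    ultimately show ?thesis
      by (simp add: er radial algebra_simps)
  qed
  with pos d1 du2 show thesis by (rule that)
qed

lemma has_derivative_powr_rescaling:
  fixes U U1 :: "real \<Rightarrow> real"
  assumes U: "\<And>r. r > 0 \<Longrightarrow> (U has_real_derivative U1 r) (at r)" and x: "x > 0"
  shows "((\<lambda>x. x powr a * U (x powr c)) has_real_derivative
    x powr (a - 1) * (a * U (x powr c) + c * x powr c * U1 (x powr c))) (at x)"
proof -
  have d: "((\<lambda>x. x powr s) has_real_derivative s * x powr (s - 1)) (at x)" for s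
    using x by (rule has_real_derivative_powr)
  have "((\<lambda>x. x powr a * U (x powr c)) has_real_derivative
      a * x powr (a - 1) * U (x powr c) + U1 (x powr c) * (c * x powr (c - 1)) * x powr a) (at x)"
    by (rule DERIV_mult[OF d DERIV_chain2[OF U d]]) (use x in simp)
  also have "a * x powr (a - 1) * U (x powr c) + U1 (x powr c) * (c * x powr (c - 1)) * x powr a
      = x powr (a - 1) * (a * U (x powr c) + c * x powr c * U1 (x powr c))"
    using x by (simp add: powr_diff field_simps)
  finally show ?thesis .
qed

lemma similarity_equation:
  fixes fr f1 u2 :: "real \<Rightarrow> real" and N m \<gamma> c \<beta> :: real
  assumes pos: "\<And>r. r > 0 \<Longrightarrow> fr r > 0"
    and f1: "\<And>r. r > 0 \<Longrightarrow> (fr has_real_derivative f1 r) (at r)"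
    and u2: "\<And>r. r > 0 \<Longrightarrow> ((\<lambda>r. fr r powr (m - 1) * f1 r) has_real_derivative u2 r) (at r)"
    and eq: "\<And>r. r > 0 \<Longrightarrow> u2 r + (N - 1) / r * (fr r powr (m - 1) * f1 r)
      + \<beta> * \<gamma> * fr r + \<beta> * r * f1 r = 0"
    and exponents: "c * (2 - \<gamma> * (1 - m)) = - 1"
  defines "w \<equiv> \<lambda>x. x powr (\<gamma> * c) * fr (x powr c)"
  obtains w1 q where "\<And>x. x > 0 \<Longrightarrow> w x > 0"
    and "\<And>x. x > 0 \<Longrightarrow> (w has_real_derivative w1 x) (at x)"
    and "\<And>x. x > 0 \<Longrightarrow> ((\<lambda>x. w x powr (m - 1) * w1 x) has_real_derivative q x) (at x)"
    and "\<And>x. x > 0 \<Longrightarrow> x\<^sup>2 * q x + (1 + c * (N - 2 - 2 * m * \<gamma>)) * x * (w x powr (m - 1) * w1 x)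
      + \<beta> * c * w1 x - c\<^sup>2 * \<gamma> * (N - 2 - m * \<gamma>) * w x powr m = 0"
proof -
  define U1 where "U1 r = fr r powr (m - 1) * f1 r" for r
  define R where "R r = \<gamma> * c * fr r powr m + c * r * U1 r" for r
  define R1 where "R1 r = \<gamma> * c * (m * U1 r) + c * U1 r + c * r * u2 r" for r
  define w1 where "w1 x = x powr (\<gamma> * c - 1) *
      (\<gamma> * c * fr (x powr c) + c * x powr c * f1 (x powr c))" for x
  define q where "q x = x powr (m * \<gamma> * c - 1 - 1) *
      ((m * \<gamma> * c - 1) * R (x powr c) + c * x powr c * R1 (x powr c))" for x
  have w_pos: "w x > 0" if "x > 0" for x
    using that pos by (simp add: w_def)
  have dw: "(w has_real_derivative w1 x) (at x)" if "x > 0" for x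
    unfolding w_def w1_def using f1 that by (rule has_derivative_powr_rescaling)
  have dR: "(R has_real_derivative R1 r) (at r)" if "r > 0" for r
  proof -
    have "((\<lambda>r. fr r powr m) has_real_derivative m * U1 r) (at r)"
      using DERIV_fun_powr[OF f1 pos, OF that that, of m] by (simp add: U1_def mult_ac)
    moreover have "(U1 has_real_derivative u2 r) (at r)"
      using u2[OF that] by (simp add: U1_def[abs_def])
    ultimately have "(R has_real_derivative \<gamma> * c * (m * U1 r) + (c * 1 * U1 r + u2 r * (c * r))) (at r)"
      unfolding R_def[abs_def] by (intro DERIV_add DERIV_cmult DERIV_mult DERIV_ident)
    then show ?thesis
      by (simp add: R1_def algebra_simps)
  qed
  have wm: "w x powr s = x powr (s * \<gamma> * c) * fr (x powr c) powr s" if "x > 0" for x s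
    using that pos[of "x powr c"] by (simp add: w_def powr_mult powr_powr mult_ac)
  have p_eq: "w x powr (m - 1) * w1 x = x powr (m * \<gamma> * c - 1) * R (x powr c)" if x: "x > 0" for x
  proof -
    have "x powr ((m - 1) * \<gamma> * c) * x powr (\<gamma> * c - 1) = x powr (m * \<gamma> * c - 1)"
      by (simp add: algebra_simps flip: powr_add)
    moreover have "fr (x powr c) powr (m - 1) * fr (x powr c) = fr (x powr c) powr m"
      using x pos[of "x powr c"] by (simp add: powr_diff)
    ultimately show ?thesis
      unfolding wm[OF x] w1_def R_def U1_def
      by (smt (verit, ccfv_threshold) distrib_left mult.assoc mult.commute)
  qed
  have dp: "((\<lambda>x. w x powr (m - 1) * w1 x) has_real_derivative q x) (at x)" if x: "x > 0" for x
  proof -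
    have "((\<lambda>x. x powr (m * \<gamma> * c - 1) * R (x powr c)) has_real_derivative q x) (at x)"
      unfolding q_def using dR x by (rule has_derivative_powr_rescaling)
    then show ?thesis
      by (rule has_derivative_cong_halfline) (use x in \<open>auto simp: p_eq\<close>)
  qed
  have "x\<^sup>2 * q x + (1 + c * (N - 2 - 2 * m * \<gamma>)) * x * (w x powr (m - 1) * w1 x)
      + \<beta> * c * w1 x - c\<^sup>2 * \<gamma> * (N - 2 - m * \<gamma>) * w x powr m = 0" if x: "x > 0" for x
  proof -
    define r where "r = x powr c"
    have r: "r > 0" using x by (simp add: r_def)
    define X where "X = x powr (m * \<gamma> * c)"
    have q: "x\<^sup>2 * q x = X * ((m * \<gamma> * c - 1) * R r + c * r * R1 r)"
      using x by (simp add: q_def r_def X_def powr_diff power2_eq_square)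
    have p: "x * (w x powr (m - 1) * w1 x) = X * R r"
      unfolding p_eq[OF x] using x by (simp add: r_def X_def powr_diff)
    have "\<gamma> * c - 1 = m * \<gamma> * c + c + c"
      using exponents by (simp add: algebra_simps)
    then have "x powr (\<gamma> * c - 1) = X * r\<^sup>2"
      unfolding X_def r_def power2_eq_square by (simp only: powr_add mult.assoc)
    then have w1: "w1 x = X * (r\<^sup>2 * (\<gamma> * c * fr r + c * r * f1 r))"
      by (simp add: w1_def r_def)
    have "r * (u2 r + (N - 1) / r * U1 r + \<beta> * \<gamma> * fr r + \<beta> * r * f1 r)
        = r * u2 r + (N - 1) * U1 r + r * (\<beta> * \<gamma> * fr r + \<beta> * r * f1 r)"
      using r by (simp add: distrib_left)
    then have eq': "r * u2 r + (N - 1) * U1 r + r * (\<beta> * \<gamma> * fr r + \<beta> * r * f1 r) = 0"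
      using eq[OF r] by (simp add: U1_def)
    have "x\<^sup>2 * q x + (1 + c * (N - 2 - 2 * m * \<gamma>)) * (x * (w x powr (m - 1) * w1 x))
        + \<beta> * c * w1 x - c\<^sup>2 * \<gamma> * (N - 2 - m * \<gamma>) * w x powr m
      = X * (c\<^sup>2 * r * (r * u2 r + (N - 1) * U1 r + r * (\<beta> * \<gamma> * fr r + \<beta> * r * f1 r)))"
      unfolding q p unfolding w1 wm[OF x] R_def R1_def X_def[symmetric] r_def[symmetric]
      by (simp add: algebra_simps power2_eq_square)
    also have "\<dots> = 0"
      unfolding eq' by simp
    finally show ?thesis
      by (simp only: mult.assoc)
  qed
  with w_pos dw dp show thesis by (rule that)
qed

lemma filterlim_powr_at_right_0:
  assumes "c > 0"
  shows "filterlim (\<lambda>x::real. x powr c) (at_right 0) (at_right 0)"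
proof -
  have pos: "\<forall>\<^sub>F x in at_right 0. (0::real) < x"
    by (rule eventually_at_right_less)
  have "((\<lambda>x::real. x powr c) \<longlongrightarrow> 0) (at_right 0)"
    by (rule tendsto_zero_powrI[OF tendsto_ident_at tendsto_const _ assms])
      (use pos in \<open>eventually_elim, simp\<close>)
  moreover have "\<forall>\<^sub>F x::real in at_right 0. x powr c \<in> {0<..} \<and> x powr c \<noteq> 0"
    using pos by eventually_elim simp
  ultimately show ?thesis
    by (simp add: filterlim_at)
qed

lemma radial_limit_at_right_0:
  fixes f :: "real^'n \<Rightarrow> real"
  assumes "((\<lambda>x. norm x powr \<gamma> * f x) \<longlongrightarrow> \<eta>) (at 0)"
    and "\<And>x. x \<noteq> 0 \<Longrightarrow> f x = fr (norm x)"
  shows "((\<lambda>r. r powr \<gamma> * fr r) \<longlongrightarrow> \<eta>) (at_right 0)"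
proof -
  obtain i :: 'n where True by simp
  let ?e = "\<lambda>r::real. r *\<^sub>R axis i 1 :: real^'n"
  have pos: "\<forall>\<^sub>F r in at_right 0. (0::real) < r"
    by (rule eventually_at_right_less)
  have "(?e \<longlongrightarrow> 0 *\<^sub>R axis i 1) (at_right 0)"
    by (intro tendsto_intros)
  moreover have "\<forall>\<^sub>F r in at_right 0. ?e r \<noteq> 0"
    using pos by eventually_elim simp
  ultimately have "filterlim ?e (at 0) (at_right 0)"
    by (simp add: filterlim_at)
  from filterlim_compose[OF assms(1) this]
  have "((\<lambda>r. norm (?e r) powr \<gamma> * f (?e r)) \<longlongrightarrow> \<eta>) (at_right 0)" .
  moreover have "\<forall>\<^sub>F r in at_right 0. norm (?e r) powr \<gamma> * f (?e r) = r powr \<gamma> * fr r"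
    using pos by eventually_elim (simp add: assms(2))
  ultimately show ?thesis
    by (rule Lim_transform_eventually)
qed

theorem theorem1p2:
  fixes f :: "real^'n \<Rightarrow> real"
    and n :: nat
    and m \<eta> \<alpha> \<beta> \<rho>\<^sub>1 \<beta>' a\<^sub>1 a\<^sub>2 a\<^sub>3 :: real
    and fr w wbar :: "real \<Rightarrow> real"
  assumes dim: "n = CARD('n)" "n \<ge> 3"
    and m: "0 < m" "m < (real n - 2) / real n"
    and eta: "\<eta> > 0"
    and beta: "\<beta> < 0"
    and rho1: "\<rho>\<^sub>1 > 0"
    and alpha: "\<alpha> = (2 * \<beta> - \<rho>\<^sub>1) / (1 - m)"
    and ratio: "2 / (1 - m) < \<alpha> / \<beta>" "\<alpha> / \<beta> < (real n - 2) / m"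
    and beta': "\<beta>' = - \<beta>"
    and solution: "elliptic_solution m \<alpha> \<beta> f"
    and radial: "\<And>x. x \<noteq> 0 \<Longrightarrow> f x = fr (norm x)"
    and lim: "((\<lambda>x. norm x powr (\<alpha> / \<beta>) * f x) \<longlongrightarrow> \<eta>) (at 0)"
    and w: "\<And>r. r > 0 \<Longrightarrow> w r = r powr (\<alpha> / \<beta>) * fr r"
    and wbar: "\<And>r. r > 0 \<Longrightarrow> wbar (r powr (\<rho>\<^sub>1 / \<beta>')) = w r"
    and a1: "a\<^sub>1 = (2 * m * \<alpha> - (real n - 2) * \<beta> + \<rho>\<^sub>1) / \<rho>\<^sub>1"
    and a2: "a\<^sub>2 = - (\<beta>\<^sup>2 / \<rho>\<^sub>1)"
    and a3: "a\<^sub>3 = (\<alpha> * \<beta> * (real n - 2) - m * \<alpha>\<^sup>2) / \<rho>\<^sub>1\<^sup>2"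
  shows "(\<exists>W1 W2. C2_halfline (wbar(0 := \<eta>)) W1 W2
            \<and> W1 0 = a\<^sub>3 / a\<^sub>2 * \<eta> powr m
            \<and> W2 0 = a\<^sub>3 * (m * a\<^sub>3 - a\<^sub>1) / a\<^sub>2\<^sup>2 * \<eta> powr (2 * m - 1))
    \<and> (\<exists>E \<in> o[at_right 0](\<lambda>\<rho>. \<rho>\<^sup>2). \<forall>\<rho>>0. wbar \<rho> =
          \<eta> + a\<^sub>3 / a\<^sub>2 * \<eta> powr m * \<rho>
            + a\<^sub>3 * (m * a\<^sub>3 - a\<^sub>1) / (2 * a\<^sub>2\<^sup>2) * \<eta> powr (2 * m - 1) * \<rho>\<^sup>2 + E \<rho>)
    \<and> (\<exists>E \<in> o[at_right 0](\<lambda>\<rho>. \<rho>). \<forall>\<rho>>0. deriv wbar \<rho> =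
          a\<^sub>3 / a\<^sub>2 * \<eta> powr m
            + a\<^sub>3 * (m * a\<^sub>3 - a\<^sub>1) / a\<^sub>2\<^sup>2 * \<eta> powr (2 * m - 1) * \<rho> + E \<rho>)
    \<and> (\<exists>E \<in> o[at_right 0](\<lambda>r. r powr (2 * \<rho>\<^sub>1 / \<beta>')). \<forall>r>0. fr r =
          r powr (- (\<alpha> / \<beta>)) *
            (\<eta> + a\<^sub>3 / a\<^sub>2 * \<eta> powr m * r powr (\<rho>\<^sub>1 / \<beta>')
              + a\<^sub>3 * (m * a\<^sub>3 - a\<^sub>1) / (2 * a\<^sub>2\<^sup>2) * \<eta> powr (2 * m - 1)
                  * r powr (2 * \<rho>\<^sub>1 / \<beta>') + E r))
    \<and> (\<exists>E \<in> o[at_right 0](\<lambda>r. r powr (\<rho>\<^sub>1 / \<beta>')). \<forall>r>0. deriv fr r =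
          r powr (- (\<alpha> / \<beta>) - 1) *
            (- (\<alpha> / \<beta>) * \<eta>
              - (2 * \<beta> - m * \<rho>\<^sub>1) * a\<^sub>3 / ((1 - m) * a\<^sub>2 * \<beta>) * \<eta> powr m
                  * r powr (\<rho>\<^sub>1 / \<beta>') + E r))"
proof -
  define \<gamma> where "\<gamma> = \<alpha> / \<beta>"
  define k where "k = \<rho>\<^sub>1 / \<beta>'"
  define c where "c = \<beta>' / \<rho>\<^sub>1"
  define L1 where "L1 = a\<^sub>3 / a\<^sub>2 * \<eta> powr m"
  define L2 where "L2 = a\<^sub>3 * (m * a\<^sub>3 - a\<^sub>1) / a\<^sub>2\<^sup>2 * \<eta> powr (2 * m - 1)"
  have kc: "k > 0" "c > 0" "c * k = 1"
    using beta rho1 beta' by (auto simp: k_def c_def divide_pos_neg divide_neg_pos)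
  have "(real n - 2) / real n < 1"
    using dim by simp
  with m have m1: "m < 1" by linarith
  have \<alpha>_eq: "\<beta> * \<gamma> = \<alpha>"
    using beta by (simp add: \<gamma>_def)
  have \<gamma>_m: "\<gamma> * (1 - m) = (2 * \<beta> - \<rho>\<^sub>1) / \<beta>"
    using m1 by (simp add: \<gamma>_def alpha)
  have exponents: "c * (2 - \<gamma> * (1 - m)) = - 1"
    unfolding \<gamma>_m using beta rho1 by (simp add: c_def beta' field_simps)
  have coeffs: "1 + c * (real n - 2 - 2 * m * \<gamma>) = a\<^sub>1" "\<beta> * c = a\<^sub>2"
    "c\<^sup>2 * \<gamma> * (real n - 2 - m * \<gamma>) = a\<^sub>3"
    unfolding a1 a2 a3 c_def beta' \<alpha>_eq[symmetric] using beta rho1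
    by (simp_all add: field_simps power2_eq_square)
  have a2_neg: "a\<^sub>2 < 0"
    using beta rho1 by (simp add: a2)
  obtain f1 u2 where prof: "\<And>r. r > 0 \<Longrightarrow> fr r > 0"
      "\<And>r. r > 0 \<Longrightarrow> (fr has_real_derivative f1 r) (at r)"
      "\<And>r. r > 0 \<Longrightarrow> ((\<lambda>r. fr r powr (m - 1) * f1 r) has_real_derivative u2 r) (at r)"
      "\<And>r. r > 0 \<Longrightarrow> u2 r + (real n - 1) / r * (fr r powr (m - 1) * f1 r)
        + \<beta> * \<gamma> * fr r + \<beta> * r * f1 r = 0"
    using radial_profile_equation[OF solution radial] m(1) unfolding dim(1) \<alpha>_eq by blast
  define W where "W x = x powr (\<gamma> * c) * fr (x powr c)" for x
  obtain w1 q where W: "\<And>x. x > 0 \<Longrightarrow> W x > 0"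
      "\<And>x. x > 0 \<Longrightarrow> (W has_real_derivative w1 x) (at x)"
      "\<And>x. x > 0 \<Longrightarrow> ((\<lambda>x. W x powr (m - 1) * w1 x) has_real_derivative q x) (at x)"
      "\<And>x. x > 0 \<Longrightarrow> x\<^sup>2 * q x + a\<^sub>1 * x * (W x powr (m - 1) * w1 x)
        + a\<^sub>2 * w1 x - a\<^sub>3 * W x powr m = 0"
    using similarity_equation[OF prof exponents] unfolding W_def[abs_def] coeffs by blast
  have pos: "\<forall>\<^sub>F x in at_right 0. (0::real) < x"
    by (rule eventually_at_right_less)
  have W_eq: "W x = wbar x" if "x > 0" for x
    using wbar[of "x powr c"] w[of "x powr c"] that kc(3)
    by (simp add: W_def powr_powr k_def[symmetric] \<gamma>_def[symmetric] mult.commute)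
  have lim_W: "(W \<longlongrightarrow> \<eta>) (at_right 0)"
  proof -
    have "((\<lambda>r. r powr \<gamma> * fr r) \<longlongrightarrow> \<eta>) (at_right 0)"
      unfolding \<gamma>_def using lim radial by (rule radial_limit_at_right_0)
    from filterlim_compose[OF this filterlim_powr_at_right_0[OF kc(2)]]
    show ?thesis
      by (simp add: W_def[abs_def] powr_powr mult.commute)
  qed
  obtain w2 where w2: "\<And>x. x > 0 \<Longrightarrow> (w1 has_real_derivative w2 x) (at x)"
      "continuous_on {0<..} w2" "(w1 \<longlongrightarrow> L1) (at_right 0)" "(w2 \<longlongrightarrow> L2) (at_right 0)"
    using degenerate_ode_limits[OF W lim_W eta a2_neg] unfolding L1_def L2_def by blast
  have lim_wbar: "(wbar \<longlongrightarrow> \<eta>) (at_right 0)"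
    using lim_W by (rule Lim_transform_eventually) (use pos in \<open>eventually_elim, simp add: W_eq\<close>)
  have wbar1: "(wbar has_real_derivative w1 x) (at x)" if "x > 0" for x
    using W(2)[OF that] that W_eq by (rule has_derivative_cong_halfline)
  note limits = lim_wbar w2(3,4)

  have C2: "C2_halfline (wbar(0 := \<eta>)) (w1(0 := L1)) (w2(0 := L2))"
    using wbar1 w2(1,2) limits by (rule C2_halfline_extension)
  have L2_half: "L2 / 2 = a\<^sub>3 * (m * a\<^sub>3 - a\<^sub>1) / (2 * a\<^sub>2\<^sup>2) * \<eta> powr (2 * m - 1)"
    by (simp add: L2_def)
  define E0 where "E0 x = wbar x - (\<eta> + L1 * x + L2 / 2 * x\<^sup>2)" for x
  have E0: "E0 \<in> o[at_right 0](\<lambda>x. x\<^sup>2)"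
    unfolding E0_def[abs_def] using wbar1 w2(1) limits by (rule taylor2_right_0)
  define E1 where "E1 x = w1 x - (L1 + L2 * x)" for x
  have E1: "E1 \<in> o[at_right 0](\<lambda>x. x)"
    unfolding E1_def[abs_def] using w2(1) limits(2,3) by (rule taylor1_right_0)
  have powr_2k: "r powr (2 * \<rho>\<^sub>1 / \<beta>') = (r powr k)\<^sup>2" for r
    by (simp add: k_def power2_eq_square flip: powr_add)
  have fr_eq: "fr r = r powr - \<gamma> * wbar (r powr k)" if "r > 0" for r
    using that wbar[OF that] w[OF that]
    by (simp add: k_def[symmetric] \<gamma>_def[symmetric] powr_minus field_simps)
  have E0k: "(\<lambda>r. E0 (r powr k)) \<in> o[at_right 0](\<lambda>r. r powr (2 * \<rho>\<^sub>1 / \<beta>'))"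
    unfolding powr_2k using E0 filterlim_powr_at_right_0[OF kc(1)]
    by (rule landau_o.small.compose)

  define F where "F x = - \<gamma> * (wbar x - (\<eta> + L1 * x)) + k * (x * (w1 x - L1))" for x
  have "(\<lambda>x. x * (w1 x - L1)) \<in> o[at_right 0](\<lambda>x. x * 1)"
  proof (rule landau_o.big_small_mult)
    show "(\<lambda>x. w1 x - L1) \<in> o[at_right 0](\<lambda>_. 1)"
      using tendsto_diff[OF w2(3) tendsto_const[of L1]] by (intro smalloI_tendsto) auto
  qed simp
  then have F: "F \<in> o[at_right 0](\<lambda>x. x)"
    unfolding F_def[abs_def] using taylor1_right_0[OF wbar1 limits(1,2)]
    by (intro sum_in_smallo) auto
  have Fk: "(\<lambda>r. F (r powr k)) \<in> o[at_right 0](\<lambda>r. r powr k)"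
    using F filterlim_powr_at_right_0[OF kc(1)] by (rule landau_o.small.compose)
  have slope: "(k - \<gamma>) * L1 = - ((2 * \<beta> - m * \<rho>\<^sub>1) * a\<^sub>3 / ((1 - m) * a\<^sub>2 * \<beta>) * \<eta> powr m)"
  proof -
    have "k - \<gamma> = - ((2 * \<beta> - m * \<rho>\<^sub>1) / ((1 - m) * \<beta>))"
      unfolding k_def beta' \<gamma>_def alpha using beta m1 by (simp add: divide_simps) (simp add: algebra_simps)
    then show ?thesis
      by (simp add: L1_def mult_ac)
  qed
  have deriv_fr: "deriv fr r = r powr (- \<gamma> - 1) * (- \<gamma> * \<eta> + (k - \<gamma>) * L1 * r powr k + F (r powr k))"
    if r: "r > 0" for r
  proof -
    have "((\<lambda>r. r powr - \<gamma> * wbar (r powr k)) has_real_derivative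
        r powr (- \<gamma> - 1) * (- \<gamma> * wbar (r powr k) + k * r powr k * w1 (r powr k))) (at r)"
      using wbar1 r by (rule has_derivative_powr_rescaling)
    then have "(fr has_real_derivative
        r powr (- \<gamma> - 1) * (- \<gamma> * wbar (r powr k) + k * r powr k * w1 (r powr k))) (at r)"
      by (rule has_derivative_cong_halfline) (use r in \<open>auto simp: fr_eq\<close>)
    then have "deriv fr r
        = r powr (- \<gamma> - 1) * (- \<gamma> * wbar (r powr k) + k * r powr k * w1 (r powr k))"
      by (rule DERIV_imp_deriv)
    then show ?thesis
      by (simp add: F_def algebra_simps)
  qed

  show ?thesis
    unfolding L1_def[symmetric] L2_def[symmetric] L2_half[symmetric] \<gamma>_def[symmetric] k_def[symmetric]
  proof (intro conjI)
    show "\<exists>W1 W2. C2_halfline (wbar(0 := \<eta>)) W1 W2 \<and> W1 0 = L1 \<and> W2 0 = L2"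
      using C2 by (intro exI[of _ "w1(0 := L1)"] exI[of _ "w2(0 := L2)"]) simp
    show "\<exists>E\<in>o[at_right 0](\<lambda>\<rho>. \<rho>\<^sup>2). \<forall>\<rho>>0. wbar \<rho> = \<eta> + L1 * \<rho> + L2 / 2 * \<rho>\<^sup>2 + E \<rho>"
      by (rule bexI[OF _ E0]) (simp add: E0_def)
    show "\<exists>E\<in>o[at_right 0](\<lambda>\<rho>. \<rho>). \<forall>\<rho>>0. deriv wbar \<rho> = L1 + L2 * \<rho> + E \<rho>"
      by (rule bexI[OF _ E1]) (simp add: E1_def DERIV_imp_deriv[OF wbar1])
    show "\<exists>E\<in>o[at_right 0](\<lambda>r. r powr (2 * \<rho>\<^sub>1 / \<beta>')). \<forall>r>0. fr r = r powr - \<gamma> *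
        (\<eta> + L1 * r powr k + L2 / 2 * r powr (2 * \<rho>\<^sub>1 / \<beta>') + E r)"
      by (rule bexI[OF _ E0k]) (simp add: E0_def powr_2k fr_eq)
    show "\<exists>E\<in>o[at_right 0](\<lambda>r. r powr k). \<forall>r>0. deriv fr r = r powr (- \<gamma> - 1) *
        (- \<gamma> * \<eta> - (2 * \<beta> - m * \<rho>\<^sub>1) * a\<^sub>3 / ((1 - m) * a\<^sub>2 * \<beta>) * \<eta> powr m * r powr k + E r)"
      by (rule bexI[OF _ Fk]) (use deriv_fr[unfolded slope] in simp)
  qed
qed

end
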